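(* Assume critical loading $\sum_i\gamma_i/\mu_i=1$ and that node $1$ is the unique bottleneck. For any solution $\bar X:[0,\infty)\to\mathbb{R}_+^J$ of the ODE $\bar X'(t)=\Psi(\bar X(t))$, we have $$\bar X(t)\to x^\dagger(\bar W(0))\quad\text{as } t\to\infty,$$ where $\bar W(0)=\beta^T(I-P^T)^{-1}\bar X(0)$ and $\Psi$ and $x^\dagger$ are as defined in the context.
   Context: Notation: all vectors are column vectors in $\mathbb{R}^J$; for vectors $x,y$, $xy$ denotes the componentwise product; $I$ is the identity matrix; $e_1$ is the first unit vector. Data. $J$ is the number of nodes; $\lambda\in\mathbb{R}_+^J$ (external arrival rates); $\mu_i>0$ (service rates), $\beta_i=1/\mu_i$; $K_i>0$ (numbers of servers); $P=(p_{ij})$ is a substochastic $J\times J$ matrix with $I-P^T$ invertible; $\gamma=(I-P^T)^{-1}\lambda$, with $\gamma_i>0$ for all $i$; $\tau=(I-P)^{-1}\beta$. Critical loading means $\sum_i\gamma_i/\mu_i=1$. Fluid model. For $x\in\mathbb{R}_+^J\setminus\{0\}$, $R_i(x)=\dfrac{\min\{x_i,K_i\}}{\sum_j\min\{x_j,K_j\}}$; by convention $R_i(0)=\gamma_i/\mu_i$. Let $R(x)=(R_i(x))_i$ and $\Psi(x)=\lambda-\mu R(x)+P^T(\mu R(x))$. Bottleneck. Node $i$ is a bottleneck if it attains $\min_j\mu_jK_j/\gamma_j$; node $1$ is the unique bottleneck when $\mu_1K_1/\gamma_1<\mu_jK_j/\gamma_j$ for all $j\ge 2$. Critical workload level: $w^*=\beta^T(I-P^T)^{-1}(\beta\gamma)\,\dfrac{\mu_1}{\gamma_1}K_1$.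 The map $x^\dagger:[0,\infty)\to\mathbb{R}_+^J$: for $0\le w\le w^*$, $$x_i^\dagger(w)=\frac{\gamma_i w}{\mu_i\,\beta^T(I-P^T)^{-1}(\beta\gamma)}=\frac{\mu_1K_1}{\gamma_1}\frac{\gamma_i}{\mu_i}\frac{w}{w^*},\quad i=1,\dots,J;$$ for $w>w^*$, $$x_1^\dagger(w)=K_1+\frac{w-w^*}{\beta^T(I-P^T)^{-1}e_1}=K_1+\frac{w-w^*}{\tau_1},\qquad x_i^\dagger(w)=\frac{\mu_1K_1}{\gamma_1}\frac{\gamma_i}{\mu_i},\quad i=2,\dots,J.$$ *)

theory Defs
  imports "HOL-Analysis.Analysis"
begin

text \<open>
  The nodes are the elements of a finite type \<open>'n\<close>. On \<^typ>\<open>real^'n\<close> the operation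
  \<open>*\<close> is the componentwise product.
\<close>

definition substochastic :: "real^'n^'n \<Rightarrow> bool" where
  "substochastic P \<longleftrightarrow> (\<forall>i j. 0 \<le> P $ i $ j) \<and> (\<forall>i. (\<Sum>j\<in>UNIV. P $ i $ j) \<le> 1)"

definition traffic_rate :: "real^'n \<Rightarrow> real^'n^'n \<Rightarrow> real^'n" where
  "traffic_rate lam P = matrix_inv (mat 1 - transpose P) *v lam"

definition mean_service :: "real^'n \<Rightarrow> real^'n" where
  "mean_service mu = (\<chi> i. 1 / mu $ i)"

definition mean_total_service :: "real^'n \<Rightarrow> real^'n^'n \<Rightarrow> real^'n" where
  "mean_total_service mu P = matrix_inv (mat 1 - P) *v mean_service mu"

definition workload :: "real^'n \<Rightarrow> real^'n^'n \<Rightarrow> real^'n \<Rightarrow> real" where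
  "workload mu P x = mean_service mu \<bullet> (matrix_inv (mat 1 - transpose P) *v x)"

definition critically_loaded :: "real^'n \<Rightarrow> real^'n \<Rightarrow> real^'n^'n \<Rightarrow> bool" where
  "critically_loaded lam mu P \<longleftrightarrow> (\<Sum>i\<in>UNIV. traffic_rate lam P $ i / mu $ i) = 1"

definition service_share ::
    "real^'n \<Rightarrow> real^'n \<Rightarrow> real^'n \<Rightarrow> real^'n^'n \<Rightarrow> real^'n \<Rightarrow> real^'n" where
  "service_share lam mu K P x =
    (if x = 0 then (\<chi> i. traffic_rate lam P $ i / mu $ i)
     else (\<chi> i. min (x $ i) (K $ i) / (\<Sum>j\<in>UNIV. min (x $ j) (K $ j))))"

definition fluid_drift ::
    "real^'n \<Rightarrow> real^'n \<Rightarrow> real^'n \<Rightarrow> real^'n^'n \<Rightarrow> real^'n \<Rightarrow> real^'n" where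
  "fluid_drift lam mu K P x =
    lam - mu * service_share lam mu K P x + transpose P *v (mu * service_share lam mu K P x)"

definition unique_bottleneck ::
    "real^'n \<Rightarrow> real^'n \<Rightarrow> real^'n \<Rightarrow> real^'n^'n \<Rightarrow> 'n \<Rightarrow> bool" where
  "unique_bottleneck lam mu K P b \<longleftrightarrow>
    (\<forall>j. j \<noteq> b \<longrightarrow> mu $ b * K $ b / traffic_rate lam P $ b < mu $ j * K $ j / traffic_rate lam P $ j)"

text \<open>
  In the next two definitions \<open>b\<close> is the bottleneck node.
\<close>

definition critical_workload ::
    "real^'n \<Rightarrow> real^'n \<Rightarrow> real^'n \<Rightarrow> real^'n^'n \<Rightarrow> 'n \<Rightarrow> real" where
  "critical_workload lam mu K P b =
    workload mu P (mean_service mu * traffic_rate lam P) * (mu $ b / traffic_rate lam P $ b) * K $ b"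

definition lifting ::
    "real^'n \<Rightarrow> real^'n \<Rightarrow> real^'n \<Rightarrow> real^'n^'n \<Rightarrow> 'n \<Rightarrow> real \<Rightarrow> real^'n" where
  "lifting lam mu K P b w =
    (if w \<le> critical_workload lam mu K P b then
       (\<chi> i. traffic_rate lam P $ i * w /
              (mu $ i * workload mu P (mean_service mu * traffic_rate lam P)))
     else
       (\<chi> i. if i = b
              then K $ b + (w - critical_workload lam mu K P b) / workload mu P (axis b 1)
              else mu $ b * K $ b / traffic_rate lam P $ b * (traffic_rate lam P $ i / mu $ i)))"

text \<open>
  The denominator used by \<^const>\<open>lifting\<close> above the critical workload is the mean total
  service of a job that enters at \<open>b\<close>.
\<close>

lemma workload_axis:
  fixes P :: "real^'n^'n"
  assumes "invertible (mat 1 - transpose P)"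
  shows "workload mu P (axis b 1) = mean_total_service mu P $ b"
proof -
  let ?A = "mat 1 - transpose P"
  have inv_works: "M ** matrix_inv M = mat 1" "matrix_inv M ** M = mat 1"
    if "invertible M" for M :: "real^'n^'n"
    using that unfolding invertible_def matrix_inv_def by (metis (mono_tags, lifting) someI_ex)+
  have tA: "transpose ?A = mat 1 - P"
    by (simp add: vec_eq_iff transpose_def mat_def)
  have invP: "invertible (mat 1 - P)"
    using transpose_invertible[OF assms] tA by simp
  have "(mat 1 - P) ** transpose (matrix_inv ?A) = mat 1"
    using arg_cong[OF inv_works(2)[OF assms], of transpose]
    by (simp add: matrix_transpose_mul tA transpose_mat)
  then have inv: "matrix_inv (mat 1 - P) = transpose (matrix_inv ?A)"
    using inv_works(2)[OF invP] by (metis matrix_mul_assoc matrix_mul_lid matrix_mul_rid)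
  have "workload mu P (axis b 1) = (transpose (matrix_inv ?A) *v mean_service mu) \<bullet> axis b 1"
    unfolding workload_def by (simp add: dot_lmul_matrix)
  then show ?thesis
    by (simp add: mean_total_service_def inv inner_axis)
qed

end

theory Submission
  imports Defs
begin

text \<open>
  Put \<open>\<rho>\<^sub>i = \<gamma>\<^sub>i / \<mu>\<^sub>i\<close>, \<open>u\<^sub>i = min x\<^sub>i K\<^sub>i / \<rho>\<^sub>i\<close> and \<open>S = \<Sum>\<^sub>j min x\<^sub>j K\<^sub>j = \<Sum>\<^sub>j \<rho>\<^sub>j u\<^sub>j\<close>. The traffic equation
  \<open>\<gamma> = \<lambda> + P\<^sup>T \<gamma>\<close> turns the fluid dynamics into a time-changed consensus dynamics,
  \<open>S X\<^sub>i' = \<lambda>\<^sub>i \<Sum>\<^sub>j \<rho>\<^sub>j (u\<^sub>j - u\<^sub>i) + \<Sum>\<^sub>j p\<^sub>j\<^sub>i \<gamma>\<^sub>j (u\<^sub>j - u\<^sub>i)\<close>,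
  for which \<open>\<tau>\<^sub>i \<gamma>\<^sub>i\<close> is an invariant measure because \<open>\<tau> = \<beta> + P \<tau>\<close>. Hence the workload
  \<open>\<tau> \<bullet> X\<close> is conserved, and \<open>\<Sum>\<^sub>i \<tau>\<^sub>i \<integral>\<^sub>0 min s K\<^sub>i / \<rho>\<^sub>i ds\<close>, with upper limit \<open>X\<^sub>i\<close>, decreases at
  rate at least \<open>\<Sum>\<^sub>i\<^sub>j \<tau>\<^sub>i \<lambda>\<^sub>i \<rho>\<^sub>j (u\<^sub>i - u\<^sub>j)\<^sup>2 / (2 S)\<close>. Since some \<open>\<lambda>\<^sub>i\<close> is positive, this rate
  vanishes only if all \<open>u\<^sub>j\<close> agree. As only the bottleneck can exceed its number of servers when
  they do, such a state is determined by its workload, so on the compact set of states with the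
  initial workload it is unique.
\<close>

section \<open>A Lyapunov convergence criterion\<close>

text \<open>By compactness \<open>g\<close> has a positive lower bound away from \<open>l\<close>,
  and the Lipschitz bound makes every excursion from \<open>l\<close> last a fixed time. So each
  excursion costs \<open>V\<close> a fixed amount, and infinitely many would make \<open>V\<close>
  negative.\<close>

lemma lyapunov_tendsto:
  fixes X :: "real \<Rightarrow> 'a::real_normed_vector" and V :: "real \<Rightarrow> real" and g :: "'a \<Rightarrow> real"
  assumes "compact C" and XC: "\<And>t. 0 \<le> t \<Longrightarrow> X t \<in> C"
    and lip: "\<And>s t. 0 \<le> s \<Longrightarrow> 0 \<le> t \<Longrightarrow> norm (X s - X t) \<le> M * \<bar>s - t\<bar>"
    and g: "continuous_on C g" and g0: "\<And>x. x \<in> C \<Longrightarrow> 0 \<le> g x"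
    and gl: "\<And>x. x \<in> C \<Longrightarrow> g x = 0 \<Longrightarrow> x = l"
    and V0: "\<And>t. 0 \<le> t \<Longrightarrow> 0 \<le> V t"
    and V': "\<And>t. 0 \<le> t \<Longrightarrow> (V has_real_derivative V' t) (at t within {0..})"
    and dec: "\<And>t. 0 \<le> t \<Longrightarrow> V' t \<le> - g (X t)"
  shows "(X \<longlongrightarrow> l) at_top"
proof (rule tendstoI)
  fix e :: real assume e: "0 < e"
  have drop: "V t \<le> V s - d * (t - s)"
    if "0 \<le> s" "s \<le> t" "\<And>r. s \<le> r \<Longrightarrow> r \<le> t \<Longrightarrow> d \<le> g (X r)" for s t d
  proof -
    have "V t + d * t \<le> V s + d * s"
    proof (rule DERIV_nonpos_imp_decreasing_open[where f = "\<lambda>r. V r + d * r"])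
      show "s \<le> t" by fact
      have "((\<lambda>r. V r + d * r) has_real_derivative V' r + d) (at r within {0..})" if "0 \<le> r" for r
        using V'[OF that] by (auto intro!: derivative_eq_intros)
      note D = this
      show "\<exists>y. ((\<lambda>r. V r + d * r) has_real_derivative y) (at r) \<and> y \<le> 0" if "s < r" "r < t" for r
      proof -
        have "at r within {0..} = at r"
          using \<open>0 \<le> s\<close> that by (intro at_within_interior) auto
        then show ?thesis
          using D[of r] dec[of r] that \<open>0 \<le> s\<close> \<open>\<And>r. s \<le> r \<Longrightarrow> r \<le> t \<Longrightarrow> d \<le> g (X r)\<close>[of r]
          by (intro exI[of _ "V' r + d"]) auto
      qed
      show "continuous_on {s..t} (\<lambda>r. V r + d * r)"
        using D \<open>0 \<le> s\<close>
        by (intro continuous_on_subset[OF DERIV_continuous_on[of "{0..}"]]) auto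
    qed
    then show ?thesis by (simp add: algebra_simps)
  qed
  \<comment> \<open>The radius is \<open>e / 2\<close> rather than \<open>e\<close>, so that a
    trajectory at distance \<open>e\<close> can move by \<open>e / 2\<close> and still be in
    \<open>C'\<close>.\<close>
  define C' where "C' = C \<inter> {x. e / 2 \<le> dist x l}"
  have "closed {x. e / 2 \<le> dist x l}"
    by (intro closed_Collect_le continuous_intros)
  then have "compact C'"
    unfolding C'_def by (rule compact_Int_closed[OF \<open>compact C\<close>])
  obtain d where d: "0 < d" "\<And>x. x \<in> C' \<Longrightarrow> d \<le> g x"
  proof (cases "C' = {}")
    case True
    then show ?thesis using that[of 1] by auto
  next
    case False
    then obtain y where y: "y \<in> C'" "\<And>x. x \<in> C' \<Longrightarrow> g y \<le> g x"
      using continuous_attains_inf[OF \<open>compact C'\<close> _ continuous_on_subset[OF g]] C'_def by blast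
    then have "g y \<noteq> 0" using gl[of y] e by (auto simp: C'_def)
    then show ?thesis using that[of "g y"] y g0[of y] by (auto simp: C'_def less_le)
  qed
  \<comment> \<open>In time \<open>h\<close> the trajectory moves at most \<open>e / 2\<close>;
    adding 1 to \<open>\<bar>M\<bar>\<close> keeps the denominator positive.\<close>
  define h where "h = e / (2 * (\<bar>M\<bar> + 1))"
  have h: "0 < h" "\<bar>M\<bar> * h \<le> e / 2"
    using e by (auto simp: h_def field_simps)
  have step: "V (t + h) \<le> V t - d * h" if "0 \<le> t" "e \<le> dist (X t) l" for t
  proof -
    have "d \<le> g (X r)" if r: "t \<le> r" "r \<le> t + h" for r
    proof (rule d)
      have "M * \<bar>r - t\<bar> \<le> \<bar>M\<bar> * h"
        using r by (intro mult_mono) auto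
      then have "dist (X r) (X t) \<le> e / 2"
        using lip[of r t] r \<open>0 \<le> t\<close> h by (auto simp: dist_norm)
      moreover have "dist (X t) l \<le> dist (X r) (X t) + dist (X r) l"
        by (rule dist_triangle3)
      ultimately show "X r \<in> C'"
        using XC[of r] r \<open>0 \<le> t\<close> \<open>e \<le> dist (X t) l\<close> by (simp add: C'_def)
    qed
    then show ?thesis using drop[of t "t + h" d] that h by auto
  qed
  have mono: "V t \<le> V s" if "0 \<le> s" "s \<le> t" for s t
    using drop[of s t 0] that g0[OF XC] by auto
  show "\<forall>\<^sub>F t in at_top. dist (X t) l < e"
  proof (rule ccontr)
    assume "\<not> ?thesis"
    then have freq: "\<exists>t\<ge>s. e \<le> dist (X t) l" for s
      by (auto simp: eventually_at_top_linorder not_less)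
    \<comment> \<open>Each round waits for the next time at distance at least \<open>e\<close>,
      during which \<open>V\<close> does not increase, and then loses \<open>d * h\<close>.\<close>
    have "\<exists>t\<ge>0. V t \<le> V 0 - real n * (d * h)" for n
    proof (induction n)
      case (Suc n)
      then obtain s where s: "0 \<le> s" "V s \<le> V 0 - real n * (d * h)" by auto
      obtain t where t: "s \<le> t" "e \<le> dist (X t) l" using freq by blast
      have "V (t + h) \<le> V 0 - real (Suc n) * (d * h)"
        using step[of t] mono[of s t] s t by (simp add: algebra_simps)
      then show ?case using s t h by (intro exI[of _ "t + h"]) auto
    qed auto
    moreover obtain n where "V 0 < real n * (d * h)"
      using reals_Archimedean3[of "d * h"] d h by auto
    ultimately show False using V0 by (metis diff_less_0_iff_less le_less_trans not_less)
  qed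
qed

section \<open>Ingredients of the Lyapunov estimate\<close>

text \<open>Minimum principle: if the least component \<open>x $ k\<close> were at most 0, row sums
  at most 1 would give \<open>x $ k \<le> (P *v x) $ k\<close>, which is
  \<open>x $ k - c $ k\<close>. It serves to show that the workload weights are positive.\<close>

lemma substochastic_supersolution_pos:
  fixes P :: "real^'n^'n"
  assumes "substochastic P" and c: "\<And>i. 0 < c $ i" and x: "x = c + P *v x"
  shows "0 < x $ i"
proof (rule ccontr)
  assume neg: "\<not> ?thesis"
  obtain k where k: "\<And>j. x $ k \<le> x $ j"
    using arg_min_if_finite(2)[of UNIV "\<lambda>j. x $ j"]
    by (metis UNIV_I UNIV_not_empty finite not_less)
  have "x $ k \<le> 0" using k[of i] neg by auto
  then have "x $ k * 1 \<le> x $ k * (\<Sum>j\<in>UNIV. P $ k $ j)"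
    using assms(1) by (intro mult_left_mono_neg) (auto simp: substochastic_def)
  also have "\<dots> \<le> (\<Sum>j\<in>UNIV. P $ k $ j * x $ j)"
    unfolding sum_distrib_left
    using k assms(1) by (intro sum_mono) (auto simp: substochastic_def mult.commute mult_right_mono)
  also have "\<dots> < x $ k"
    using c[of k] by (subst (2) x) (simp add: matrix_vector_mult_def)
  finally show False by simp
qed

text \<open>Expand the squares on the right. The diagonal terms collapse by the traffic equation
  (sums over \<open>j\<close>) and by the equation for \<open>tau\<close> (sums over
  \<open>i\<close>): the two double sums become \<open>G1 + G2 - 2 * B\<close> and
  \<open>2 * G - G1 - G2 - 2 * A\<close>, so \<open>G1\<close> and \<open>G2\<close> cancel.\<close>

lemma traffic_dissipation:
  fixes P :: "real^'n^'n" and lam gam tau bet :: "real^'n" and u :: "'n \<Rightarrow> real"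
  assumes gam: "gam = lam + transpose P *v gam" and tau: "tau = bet + P *v tau"
    and one: "(\<Sum>i\<in>UNIV. bet $ i * gam $ i) = 1"
  shows "2 * (\<Sum>i\<in>UNIV. tau $ i * u i * (lam $ i * (\<Sum>j\<in>UNIV. bet $ j * gam $ j * u j)
             - gam $ i * u i + (\<Sum>j\<in>UNIV. P $ j $ i * (gam $ j * u j)))) =
    - (\<Sum>i\<in>UNIV. \<Sum>j\<in>UNIV. tau $ i * lam $ i * (bet $ j * gam $ j) * (u i - u j)\<^sup>2)
    - (\<Sum>i\<in>UNIV. \<Sum>j\<in>UNIV. tau $ i * P $ j $ i * gam $ j * (u i - u j)\<^sup>2)"
proof -
  have gam': "gam $ i = lam $ i + (\<Sum>j\<in>UNIV. P $ j $ i * gam $ j)" for i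
    by (subst gam) (simp add: matrix_vector_mult_def transpose_def)
  have tau': "tau $ i = bet $ i + (\<Sum>j\<in>UNIV. P $ i $ j * tau $ j)" for i
    by (subst tau) (simp add: matrix_vector_mult_def)
  define A where "A = (\<Sum>i\<in>UNIV. \<Sum>j\<in>UNIV. tau $ i * P $ j $ i * gam $ j * (u i * u j))"
  define B where "B = (\<Sum>i\<in>UNIV. tau $ i * lam $ i * u i) * (\<Sum>j\<in>UNIV. bet $ j * gam $ j * u j)"
  define G where "G = (\<Sum>i\<in>UNIV. tau $ i * gam $ i * (u i)\<^sup>2)"
  define G1 where "G1 = (\<Sum>i\<in>UNIV. tau $ i * lam $ i * (u i)\<^sup>2)"
  define G2 where "G2 = (\<Sum>i\<in>UNIV. bet $ i * gam $ i * (u i)\<^sup>2)"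
  have tp: "(\<Sum>i\<in>UNIV. \<Sum>j\<in>UNIV. tau $ i * P $ j $ i * gam $ j * (f i)) =
      (\<Sum>i\<in>UNIV. tau $ i * gam $ i * f i) - (\<Sum>i\<in>UNIV. tau $ i * lam $ i * f i)" for f
    unfolding sum_subtractf[symmetric]
  proof (rule sum.cong[OF refl])
    fix i
    have "(\<Sum>j\<in>UNIV. tau $ i * P $ j $ i * gam $ j * f i) = tau $ i * (gam $ i - lam $ i) * f i"
      by (subst gam') (simp add: sum_distrib_left sum_distrib_right mult.assoc)
    then show "(\<Sum>j\<in>UNIV. tau $ i * P $ j $ i * gam $ j * f i)
        = tau $ i * gam $ i * f i - tau $ i * lam $ i * f i"
      by (simp add: algebra_simps)
  qed
  have pt: "(\<Sum>i\<in>UNIV. \<Sum>j\<in>UNIV. tau $ i * P $ j $ i * gam $ j * (f j)) =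
      (\<Sum>i\<in>UNIV. tau $ i * gam $ i * f i) - (\<Sum>i\<in>UNIV. bet $ i * gam $ i * f i)" for f
    unfolding sum_subtractf[symmetric]
  proof (subst sum.swap, rule sum.cong[OF refl])
    fix j
    have "(\<Sum>i\<in>UNIV. tau $ i * P $ j $ i * gam $ j * f j) = (tau $ j - bet $ j) * gam $ j * f j"
      by (subst tau') (simp add: sum_distrib_left sum_distrib_right mult.commute mult.left_commute)
    then show "(\<Sum>i\<in>UNIV. tau $ i * P $ j $ i * gam $ j * f j)
        = tau $ j * gam $ j * f j - bet $ j * gam $ j * f j"
      by (simp add: algebra_simps)
  qed
  \<comment> \<open>For constant \<open>f\<close> the left sides of \<open>tp\<close> and
    \<open>pt\<close> coincide, so \<open>tau\<close> and \<open>lam\<close> pair to the same value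
    as \<open>bet\<close> and \<open>gam\<close>.\<close>
  have tl: "(\<Sum>i\<in>UNIV. tau $ i * lam $ i) = 1"
    using tp[of "\<lambda>_. 1"] pt[of "\<lambda>_. 1"] one by simp
  have "(\<Sum>i\<in>UNIV. \<Sum>j\<in>UNIV. tau $ i * P $ j $ i * gam $ j * (u i - u j)\<^sup>2)
      = (G - G1) + (G - G2) - 2 * A"
    unfolding G_def G1_def G2_def A_def tp[symmetric] pt[symmetric]
    by (simp add: power2_diff algebra_simps sum.distrib sum_subtractf sum_distrib_left)
  moreover have "(\<Sum>i\<in>UNIV. \<Sum>j\<in>UNIV. tau $ i * lam $ i * (bet $ j * gam $ j) * (u i - u j)\<^sup>2)
      = G1 * (\<Sum>i\<in>UNIV. bet $ i * gam $ i) + (\<Sum>i\<in>UNIV. tau $ i * lam $ i) * G2 - 2 * B"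
    unfolding G1_def G2_def B_def sum_product
    by (simp add: power2_diff algebra_simps sum.distrib sum_subtractf sum_distrib_left)
  moreover have "(\<Sum>i\<in>UNIV. tau $ i * u i * (lam $ i * (\<Sum>j\<in>UNIV. bet $ j * gam $ j * u j)
             - gam $ i * u i + (\<Sum>j\<in>UNIV. P $ j $ i * (gam $ j * u j)))) = B - G + A"
    unfolding G_def B_def A_def
    by (simp add: power2_eq_square algebra_simps sum.distrib sum_subtractf sum_distrib_left)
  ultimately show ?thesis using tl one by simp
qed

text \<open>The differentiated function is \<open>\<integral>\<^sub>0\<^sup>x min s k ds\<close> in closed form when \<open>0 \<le> x\<close> and \<open>0 \<le> k\<close>.\<close>

lemma has_real_derivative_integral_min:
  fixes k :: real
  shows "((\<lambda>x. (x\<^sup>2 - (max 0 (x - k))\<^sup>2) / 2) has_real_derivative min x k) (at x)"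
proof -
  \<comment> \<open>Squaring removes the kink of the positive part: at 0 the difference quotient is
    bounded by \<open>\<bar>h\<bar>\<close>.\<close>
  have sq: "((\<lambda>y. (max 0 y)\<^sup>2) has_real_derivative 2 * max 0 y) (at y)" for y :: real
  proof -
    consider "y < 0" | "y = 0" | "y > 0" by linarith
    then show ?thesis
    proof cases
      case 1
      show ?thesis
        by (rule has_field_derivative_transform_within_open[where f = "\<lambda>_. 0" and S = "{..<0}"])
          (use 1 in auto)
    next
      case 2
      have "(\<lambda>h. (max 0 h)\<^sup>2 / h) \<midarrow>0\<rightarrow> (0::real)"
      proof (rule Lim_null_comparison[where g = "\<lambda>h. \<bar>h\<bar>"])
        show "\<forall>\<^sub>F h in at 0. norm ((max 0 h)\<^sup>2 / h) \<le> \<bar>h::real\<bar>"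
          by (intro always_eventually) (auto simp: max_def power2_eq_square)
      qed (auto intro!: tendsto_eq_intros)
      then show ?thesis using 2 by (simp add: DERIV_def)
    next
      case 3
      show ?thesis
        by (rule has_field_derivative_transform_within_open[where f = "\<lambda>z. z\<^sup>2" and S = "{0<..}"])
          (use 3 in \<open>auto intro!: derivative_eq_intros\<close>)
    qed
  qed
  have "((\<lambda>x. (max 0 (x - k))\<^sup>2) has_real_derivative 2 * max 0 (x - k) * 1) (at x)"
    by (rule DERIV_chain2[OF sq]) (auto intro!: derivative_eq_intros)
  then show ?thesis
    by (rule DERIV_cong[OF DERIV_cdivide[OF DERIV_diff[OF DERIV_pow]]]) (auto simp: max_def min_def)
qed

section \<open>Traffic equation and workload functional\<close>

lemma matrix_inv_mult_vec:
  fixes A :: "real^'n^'n"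
  assumes "invertible A"
  shows "A *v (matrix_inv A *v x) = x" and "matrix_inv A *v (A *v x) = x"
    and "x v* matrix_inv A v* A = x"
proof -
  have "A ** matrix_inv A = mat 1 \<and> matrix_inv A ** A = mat 1"
    using assms unfolding invertible_def matrix_inv_def by (rule someI_ex)
  then show "A *v (matrix_inv A *v x) = x" "matrix_inv A *v (A *v x) = x"
    "x v* matrix_inv A v* A = x"
    by (simp_all add: matrix_vector_mul_assoc vector_matrix_mul_assoc)
qed

lemma traffic_equation:
  fixes P :: "real^'n^'n"
  assumes "invertible (mat 1 - transpose P)"
  shows "traffic_rate lam P = lam + transpose P *v traffic_rate lam P"
  using matrix_inv_mult_vec(1)[OF assms, of lam]
  by (simp add: traffic_rate_def matrix_vector_mult_diff_rdistrib algebra_simps)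

lemma workload_eq_inner:
  fixes P :: "real^'n^'n"
  assumes "invertible (mat 1 - transpose P)"
  shows "workload mu P x = mean_total_service mu P \<bullet> x"
    and "mean_total_service mu P = mean_service mu + P *v mean_total_service mu P"
proof -
  define y where "y = mean_service mu v* matrix_inv (mat 1 - transpose P)"
  have y: "workload mu P x = y \<bullet> x" for x
    by (simp add: workload_def y_def dot_lmul_matrix)
  \<comment> \<open>The workload is linear with coefficient vector \<open>y\<close>; evaluating it
    at unit vectors by \<open>workload_axis\<close> identifies \<open>y\<close>.\<close>
  have eq: "mean_total_service mu P = y"
    using workload_axis[OF assms, of mu] by (simp add: vec_eq_iff y inner_axis)
  show "workload mu P x = mean_total_service mu P \<bullet> x"
    by (simp add: eq y)
  have "y v* (mat 1 - transpose P) = mean_service mu"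
    unfolding y_def by (rule matrix_inv_mult_vec(3)[OF assms])
  moreover have "y v* (mat 1 - transpose P) = y - P *v y"
    by (simp add: vector_matrix_mult_diff_rdistrib vector_transpose_matrix)
  ultimately show "mean_total_service mu P = mean_service mu + P *v mean_total_service mu P"
    by (simp add: eq algebra_simps)
qed

section \<open>Service shares and the fluid drift\<close>

lemma sum_min_pos:
  fixes x K :: "real^'n"
  assumes "\<And>i. 0 < K $ i" and "\<And>i. 0 \<le> x $ i" and "x \<noteq> 0"
  shows "0 < (\<Sum>j\<in>UNIV. min (x $ j) (K $ j))"
proof -
  obtain i where "x $ i \<noteq> 0" using assms(3) by (auto simp: vec_eq_iff)
  then have "0 < min (x $ i) (K $ i)" using assms(1,2)[of i] by auto
  then show ?thesis
    using assms(1,2) by (intro sum_pos2[of _ i]) (auto simp: less_imp_le)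
qed

text \<open>At the origin the sum is 1 because of critical loading; elsewhere it is 1 by
  normalization.\<close>

lemma service_share_nonneg_sum:
  fixes x K :: "real^'n"
  assumes "critically_loaded lam mu P" and "\<And>i. 0 < mu $ i" and "\<And>i. 0 < traffic_rate lam P $ i"
    and "\<And>i. 0 < K $ i" and "\<And>i. 0 \<le> x $ i"
  shows "0 \<le> service_share lam mu K P x $ i"
    and "(\<Sum>i\<in>UNIV. service_share lam mu K P x $ i) = 1"
proof -
  have "0 \<le> service_share lam mu K P x $ i \<and> (\<Sum>i\<in>UNIV. service_share lam mu K P x $ i) = 1"
  proof (cases "x = 0")
    case True
    then show ?thesis
      using assms(1-3) by (simp add: service_share_def critically_loaded_def less_imp_le)
  next
    case False
    then show ?thesis
      using sum_min_pos[OF assms(4,5) False] assms(4,5)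
      by (simp add: service_share_def sum_divide_distrib[symmetric] less_imp_le)
  qed
  then show "0 \<le> service_share lam mu K P x $ i"
    and "(\<Sum>i\<in>UNIV. service_share lam mu K P x $ i) = 1" by auto
qed

lemma fluid_drift_eq:
  fixes P :: "real^'n^'n"
  assumes "invertible (mat 1 - transpose P)"
  shows "fluid_drift lam mu K P x =
    (mat 1 - transpose P) *v (traffic_rate lam P - mu * service_share lam mu K P x)"
  using matrix_inv_mult_vec(1)[OF assms, of lam]
  by (simp add: fluid_drift_def traffic_rate_def matrix_vector_mult_diff_distrib
      matrix_vector_mult_diff_rdistrib)

text \<open>The share need not be continuous at the origin, so compactness is applied to the share
  instead of the state: the drift is a continuous function \<open>f\<close> of a vector in the unit
  ball.\<close>

lemma bounded_fluid_drift:
  fixes P :: "real^'n^'n"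
  assumes "critically_loaded lam mu P" and "\<And>i. 0 < mu $ i" and "\<And>i. 0 < traffic_rate lam P $ i"
    and "\<And>i. 0 < K $ i"
  obtains M where "\<And>x. (\<And>i. 0 \<le> x $ i) \<Longrightarrow> norm (fluid_drift lam mu K P x) \<le> M"
proof -
  define f where "f r = lam - mu * r + transpose P *v (mu * r)" for r :: "real^'n"
  have "continuous_on (cball 0 1) f"
    unfolding f_def times_vec_def matrix_vector_mult_def by (intro continuous_intros)
  then have "compact (f ` cball 0 1)"
    by (rule compact_continuous_image) simp
  then have "bounded (f ` cball 0 1)"
    by (rule compact_imp_bounded)
  then obtain M where M: "norm (f r) \<le> M" if "norm r \<le> 1" for r
    unfolding bounded_iff by (metis image_eqI mem_cball_0)
  have "norm (fluid_drift lam mu K P x) \<le> M" if "\<And>i. 0 \<le> x $ i" for x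
  proof -
    have "norm (service_share lam mu K P x) \<le> 1"
      using norm_le_l1_cart[of "service_share lam mu K P x"]
        service_share_nonneg_sum[OF assms that] by simp
    then show ?thesis using M by (simp add: f_def fluid_drift_def)
  qed
  then show ?thesis by (rule that)
qed

text \<open>The workload inverts the factor \<open>mat 1 - transpose P\<close> of the drift, and its
  weights \<open>1 / mu $ i\<close> cancel the service rates. What remains is the difference of two
  sums equal to 1.\<close>

lemma workload_fluid_drift:
  fixes P :: "real^'n^'n"
  assumes "invertible (mat 1 - transpose P)"
    and "critically_loaded lam mu P" and "\<And>i. 0 < mu $ i" and "\<And>i. 0 < traffic_rate lam P $ i"
    and "\<And>i. 0 < K $ i" and "\<And>i. 0 \<le> x $ i"
  shows "workload mu P (fluid_drift lam mu K P x) = 0"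
proof -
  have "mu $ i \<noteq> 0" for i using assms(3)[of i] by simp
  then have "workload mu P (fluid_drift lam mu K P x)
      = (\<Sum>i\<in>UNIV. traffic_rate lam P $ i / mu $ i) - (\<Sum>i\<in>UNIV. service_share lam mu K P x $ i)"
    by (simp add: workload_def fluid_drift_eq[OF assms(1)] matrix_inv_mult_vec(2)[OF assms(1)]
        inner_vec_def mean_service_def diff_divide_distrib sum_subtractf)
  then show ?thesis
    using service_share_nonneg_sum(2)[OF assms(2-6)] assms(2) by (simp add: critically_loaded_def)
qed

text \<open>Clearing the denominator gives an identity that also covers the origin, where both sides
  vanish whatever the share is there.\<close>

lemma fluid_drift_scaled:
  fixes x K :: "real^'n"
  assumes "\<And>i. 0 < K $ i" and "\<And>i. 0 \<le> x $ i"
  defines "m \<equiv> \<lambda>i. min (x $ i) (K $ i)"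
  shows "(\<Sum>j\<in>UNIV. m j) * fluid_drift lam mu K P x $ i =
    lam $ i * (\<Sum>j\<in>UNIV. m j) - mu $ i * m i + (\<Sum>j\<in>UNIV. P $ j $ i * (mu $ j * m j))"
proof -
  define S where "S = (\<Sum>j\<in>UNIV. m j)"
  have "(\<Sum>j\<in>UNIV. m j) * service_share lam mu K P x $ i = m i" for i
  proof (cases "x = 0")
    case True
    then have "m i = 0" for i using assms(1)[of i] by (simp add: m_def)
    then show ?thesis by simp
  next
    case False
    then show ?thesis
      using sum_min_pos[OF assms(1,2) False] by (simp add: service_share_def m_def)
  qed
  then have share: "m i = S * service_share lam mu K P x $ i" for i
    by (simp add: S_def)
  show ?thesis
    unfolding S_def[symmetric] unfolding share
    by (simp add: fluid_drift_def matrix_vector_mult_def transpose_def algebra_simps sum_distrib_left)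
qed

section \<open>States with a common ratio\<close>

text \<open>The common ratio \<open>u\<close> cannot exceed \<open>v\<close>, the capacity ratio of
  \<open>b\<close>, which is strictly smallest. Hence every other node stays below its capacity, and
  \<open>x\<close> is either a multiple of \<open>rho\<close> or \<open>v *\<^sub>R rho\<close> plus
  excess at \<open>b\<close>. The workload fixes the free coefficient.\<close>

lemma lifting_unique:
  fixes x :: "real^'n"
  assumes inv: "invertible (mat 1 - transpose P)" and mu: "\<And>i. 0 < mu $ i"
    and gam: "\<And>i. 0 < traffic_rate lam P $ i" and tau: "\<And>i. 0 < mean_total_service mu P $ i"
    and b: "unique_bottleneck lam mu K P b"
    and u: "\<And>i. min (x $ i) (K $ i) = traffic_rate lam P $ i / mu $ i * u"
  shows "x = lifting lam mu K P b (workload mu P x)"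
proof -
  let ?W = "workload mu P" and ?tau = "mean_total_service mu P"
  define rho where "rho = mean_service mu * traffic_rate lam P"
  have rho: "rho $ i = traffic_rate lam P $ i / mu $ i" "0 < rho $ i" for i
    using mu[of i] gam[of i] by (simp_all add: rho_def mean_service_def)
  have u': "min (x $ i) (K $ i) = rho $ i * u" for i using u rho(1) by simp
  define v where "v = K $ b / rho $ b"
  have v: "rho $ j * v < K $ j" if "j \<noteq> b" for j
    using b that mu[of j] mu[of b] gam[of j] gam[of b]
    by (auto simp: unique_bottleneck_def v_def rho field_simps)
  have vb: "rho $ b * v = K $ b" using rho(2)[of b] by (simp add: v_def)
  have Wrho: "0 < ?W rho"
    using tau rho(2) by (auto simp: workload_eq_inner(1)[OF inv] inner_vec_def intro!: sum_pos)
  have crit: "critical_workload lam mu K P b = ?W rho * v"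
    by (simp add: critical_workload_def rho_def[symmetric] v_def rho)
  have lift: "lifting lam mu K P b w = (if w \<le> ?W rho * v then (w / ?W rho) *\<^sub>R rho
      else v *\<^sub>R rho + ((w - ?W rho * v) / ?tau $ b) *\<^sub>R axis b 1)" for w
  proof -
    have "mu $ b * K $ b / traffic_rate lam P $ b = v"
      by (simp add: v_def rho(1))
    moreover have "axis b (1::real) $ i = (if i = b then 1 else 0)" for i
      by (simp add: axis_def)
    moreover have "traffic_rate lam P $ i * w / (mu $ i * ?W rho) = w / ?W rho * rho $ i" for i
      by (simp add: rho(1) mult.commute)
    ultimately show ?thesis
      using vb by (simp add: lifting_def crit rho_def[symmetric] workload_axis[OF inv] vec_eq_iff
          rho(1)[symmetric] mult.commute[of v])
  qed
  have W: "?W (c *\<^sub>R y + d *\<^sub>R z) = c * ?W y + d * ?W z" for c d y z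
    by (simp add: workload_eq_inner(1)[OF inv] inner_add_right)
  have uv: "u \<le> v"
    using u'[of b] vb rho(2)[of b] by (metis min.cobounded2 mult_le_cancel_left_pos)
  have others: "x $ j = rho $ j * u" if "j \<noteq> b" for j
  proof -
    have "rho $ j * u \<le> rho $ j * v" using uv rho(2)[of j] by simp
    then show ?thesis using v[OF that] u'[of j] by (auto simp: min_def split: if_splits)
  qed
  show ?thesis
  proof (cases "x $ b \<le> K $ b")
    case True
    \<comment> \<open>The zero summand gives \<open>x\<close> the two-term shape of
      \<open>W\<close>.\<close>
    then have "x = u *\<^sub>R rho + 0 *\<^sub>R 0"
      using others u'[of b] by (simp add: vec_eq_iff) (metis min.absorb1 mult.commute)
    moreover from this have "?W x = u * ?W rho" using W[of u rho 0 0] by simp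
    ultimately show ?thesis using uv Wrho by (simp add: lift mult.commute)
  next
    case False
    then have "u = v" using u'[of b] rho(2)[of b] by (simp add: v_def)
    then have x: "x = v *\<^sub>R rho + (x $ b - K $ b) *\<^sub>R axis b 1"
      using others vb by (auto simp: vec_eq_iff axis_def mult.commute)
    then have "?W x = ?W rho * v + (x $ b - K $ b) * ?tau $ b"
      using W[of v rho "x $ b - K $ b" "axis b 1"] by (simp add: workload_axis[OF inv] mult.commute)
    \<comment> \<open>Positive excess at \<open>b\<close> and \<open>tau > 0\<close> put the
      workload strictly above the critical level, which selects the second branch of
      \<open>lifting\<close>.\<close>
    then show ?thesis
      using False tau[of b] x by (simp add: lift mult_le_0_iff)
  qed
qed

section \<open>Convergence of the fluid model\<close>

theorem proposition3:
  fixes lam mu K :: "real^'n" and P :: "real^'n^'n" and b :: 'n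
    and X :: "real \<Rightarrow> real^'n"
  assumes "\<And>i. 0 \<le> lam $ i"
    and "\<And>i. 0 < mu $ i"
    and "\<And>i. 0 < K $ i"
    and "substochastic P"
    and "invertible (mat 1 - transpose P)"
    and "\<And>i. 0 < traffic_rate lam P $ i"
    and "critically_loaded lam mu P"
    and "unique_bottleneck lam mu K P b"
    and "\<And>t i. 0 \<le> t \<Longrightarrow> 0 \<le> X t $ i"
    and "\<And>t. 0 \<le> t \<Longrightarrow>
           (X has_vector_derivative fluid_drift lam mu K P (X t)) (at t within {0..})"
  shows "(X \<longlongrightarrow> lifting lam mu K P b (workload mu P (X 0))) at_top"
proof -
  note lam = assms(1) and mu = assms(2) and K = assms(3) and P = assms(4) and inv = assms(5)
    and gam = assms(6) and crit = assms(7) and X0 = assms(9) and X' = assms(10)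
  define tau where "tau = mean_total_service mu P"
  define gam' where "gam' = traffic_rate lam P"
  define bet where "bet = mean_service mu"
  have bet: "bet $ i = 1 / mu $ i" "0 < bet $ i" for i
    using mu by (simp_all add: bet_def mean_service_def)
  have gam_eq: "gam' = lam + transpose P *v gam'"
    unfolding gam'_def by (rule traffic_equation[OF inv])
  have gam'_pos: "0 < gam' $ i" for i using gam by (simp add: gam'_def)
  have tau_eq: "tau = bet + P *v tau"
    unfolding tau_def bet_def by (rule workload_eq_inner(2)[OF inv])
  have tau_pos: "0 < tau $ i" for i
    by (rule substochastic_supersolution_pos[OF P bet(2) tau_eq])
  have one: "(\<Sum>i\<in>UNIV. bet $ i * gam' $ i) = 1"
    using crit by (simp add: critically_loaded_def bet gam'_def)
  have W: "workload mu P x = tau \<bullet> x" for x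
    unfolding tau_def by (rule workload_eq_inner(1)[OF inv])

  define m where "m x i = min (x $ i) (K $ i)" for x i
  define u where "u x i = m x i * mu $ i / gam' $ i" for x i
  have mu_ne: "mu $ i \<noteq> 0" and gam_ne: "gam' $ i \<noteq> 0" for i
    using mu[of i] gam'_pos[of i] by simp_all
  define k where "k = (\<Sum>i\<in>UNIV. K $ i)"
  have k: "0 < k" unfolding k_def using K by (intro sum_pos) auto
  \<comment> \<open>The constant \<open>k\<close> bounds the total service effort in every state.
    Using it as the denominator keeps \<open>g\<close> continuous at the origin, where the effort
    vanishes.\<close>
  define g where "g x = (\<Sum>i\<in>UNIV. \<Sum>j\<in>UNIV. tau $ i * lam $ i * (bet $ j * gam' $ j) *
      (u x i - u x j)\<^sup>2) / (2 * k)" for x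
  define C where "C = {x. (\<forall>i. 0 \<le> x $ i) \<and> workload mu P x = workload mu P (X 0)}"
  define F where "F c s = (s\<^sup>2 - (max 0 (s - c))\<^sup>2) / 2" for c s :: real
  \<comment> \<open>\<open>F (K $ i)\<close> is a primitive of \<open>min s (K $ i)\<close>, so the
    chain rule produces the factor \<open>u (X t) i\<close> in \<open>V'\<close>.\<close>
  define V where "V t = (\<Sum>i\<in>UNIV. tau $ i * (mu $ i / gam' $ i) * F (K $ i) (X t $ i))" for t
  define V' where "V' t = (\<Sum>i\<in>UNIV. tau $ i * u (X t) i * fluid_drift lam mu K P (X t) $ i)" for t

  have g0: "0 \<le> g x" for x
    using tau_pos gam'_pos bet(2) lam k
    by (auto simp: g_def less_imp_le intro!: sum_nonneg mult_nonneg_nonneg divide_nonneg_pos)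
  have dissip: "(\<Sum>i\<in>UNIV. tau $ i * u x i * fluid_drift lam mu K P x $ i) \<le> - g x"
    if x: "\<And>i. 0 \<le> x $ i" for x
  proof -
    define S where "S = (\<Sum>j\<in>UNIV. m x j)"
    define D where "D = (\<Sum>i\<in>UNIV. tau $ i * u x i * fluid_drift lam mu K P x $ i)"
    have S: "0 \<le> S" "S \<le> k"
      using x K by (auto simp: S_def k_def m_def less_imp_le intro!: sum_nonneg sum_mono)
    have gu: "gam' $ i * u x i = mu $ i * m x i" "bet $ i * gam' $ i * u x i = m x i" for i
      using mu_ne[of i] gam_ne[of i] by (simp_all add: u_def bet)
    have "S * D = (\<Sum>i\<in>UNIV. tau $ i * u x i * (S * fluid_drift lam mu K P x $ i))"
      by (simp add: D_def sum_distrib_left algebra_simps)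
    also have "\<dots> = (\<Sum>i\<in>UNIV. tau $ i * u x i * (lam $ i * (\<Sum>j\<in>UNIV. bet $ j * gam' $ j * u x j)
             - gam' $ i * u x i + (\<Sum>j\<in>UNIV. P $ j $ i * (gam' $ j * u x j))))"
      unfolding gu S_def m_def fluid_drift_scaled[OF K x] ..
    finally have "2 * (S * D) = - (2 * k * g x)
        - (\<Sum>i\<in>UNIV. \<Sum>j\<in>UNIV. tau $ i * P $ j $ i * gam' $ j * (u x i - u x j)\<^sup>2)"
      using traffic_dissipation[OF gam_eq tau_eq one, of "u x"] k by (simp add: g_def)
    \<comment> \<open>The routing part of the dissipation has the right sign and is dropped;
      external arrivals alone will separate the limit.\<close>
    moreover have "0 \<le> (\<Sum>i\<in>UNIV. \<Sum>j\<in>UNIV. tau $ i * P $ j $ i * gam' $ j * (u x i - u x j)\<^sup>2)"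
      using tau_pos gam'_pos P
      by (auto simp: substochastic_def less_imp_le intro!: sum_nonneg mult_nonneg_nonneg)
    ultimately have SD: "S * D \<le> - (k * g x)" by simp
    show ?thesis
    proof (cases "x = 0")
      case True
      then have "u x i = 0" for i using K[of i] by (simp add: u_def m_def)
      then show ?thesis by (simp add: g_def)
    next
      case False
      then have "0 < S"
        unfolding S_def m_def using sum_min_pos[OF K x] by simp
      \<comment> \<open>Weakening \<open>k\<close> to \<open>S\<close> allows cancelling the
        positive factor \<open>S\<close>.\<close>
      have "S * g x \<le> k * g x" using S g0 by (intro mult_right_mono)
      then have "S * D \<le> S * (- g x)" using SD by simp
      then show ?thesis using \<open>0 < S\<close> unfolding D_def by (rule mult_left_le_imp_le)
    qed
  qed

  have cont_u: "continuous_on A (\<lambda>x. u x i)" for A i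
    unfolding u_def m_def by (intro continuous_intros) (simp add: gam_ne)
  have Xi': "((\<lambda>t. X t $ i) has_real_derivative fluid_drift lam mu K P (X t) $ i) (at t within {0..})"
    if "0 \<le> t" for t i
    using bounded_linear.has_vector_derivative[OF bounded_linear_vec_nth X'[OF that]]
    by (simp add: has_real_derivative_iff_has_vector_derivative)
  obtain M where M: "\<And>x. (\<And>i. 0 \<le> x $ i) \<Longrightarrow> norm (fluid_drift lam mu K P x) \<le> M"
    using bounded_fluid_drift[OF crit mu gam K] by blast

  show ?thesis
  proof (rule lyapunov_tendsto[where C = C and V = V and V' = V' and g = g and M = M])
    have "closed C"
      unfolding C_def W
      by (intro closed_Collect_conj closed_Collect_all closed_Collect_le closed_Collect_eq
          continuous_intros)
    moreover have "bounded C"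
    proof (rule bounded_subset)
      \<comment> \<open>Nonnegative coordinates with positive weights \<open>tau\<close> cannot
        exceed the workload divided by their weight.\<close>
      define c where "c = (\<chi> i. workload mu P (X 0) / tau $ i)"
      show "bounded (cbox 0 c)" by simp
      show "C \<subseteq> cbox 0 c"
      proof
        fix x assume x: "x \<in> C"
        have "tau $ i * x $ i \<le> workload mu P (X 0)" for i
        proof -
          have "tau $ i * x $ i \<le> tau \<bullet> x"
            unfolding inner_vec_def inner_real_def
            using x tau_pos by (intro member_le_sum) (auto simp: C_def less_imp_le)
          then show ?thesis using x by (simp add: C_def W)
        qed
        then show "x \<in> cbox 0 c"
          using x tau_pos by (auto simp: mem_box_cart c_def C_def field_simps)
      qed
    qed
    ultimately show "compact C" by (simp add: compact_eq_bounded_closed)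
    have conserved: "workload mu P (X t) = workload mu P (X 0)" if "0 \<le> t" for t
    proof (rule has_derivative_zero_unique[of "{0..}" "\<lambda>t. workload mu P (X t)"])
      fix s :: real assume "s \<in> {0..}"
      then have "((\<lambda>t. tau \<bullet> X t) has_vector_derivative tau \<bullet> fluid_drift lam mu K P (X s))
          (at s within {0..})"
        by (intro bounded_linear.has_vector_derivative[OF bounded_linear_inner_right X']) simp
      moreover have "tau \<bullet> fluid_drift lam mu K P (X s) = 0"
        using workload_fluid_drift[OF inv crit mu gam K X0] \<open>s \<in> {0..}\<close> by (simp add: W)
      ultimately show "((\<lambda>t. workload mu P (X t)) has_derivative (\<lambda>h. 0)) (at s within {0..})"
        by (simp add: W has_vector_derivative_def)
    qed (use that in auto)
    show "X t \<in> C" if "0 \<le> t" for t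
      using conserved[OF that] X0[OF that] by (simp add: C_def)
    show "norm (X s - X t) \<le> M * \<bar>s - t\<bar>" if "0 \<le> s" "0 \<le> t" for s t
    proof -
      have "norm (X s - X t) \<le> M * norm (s - t)"
      proof (rule differentiable_bound[of "{0..}"])
        fix r :: real assume r: "r \<in> {0..}"
        show "(X has_derivative (\<lambda>h. h *\<^sub>R fluid_drift lam mu K P (X r))) (at r within {0..})"
          using X'[of r] r by (simp add: has_vector_derivative_def)
        show "onorm (\<lambda>h. h *\<^sub>R fluid_drift lam mu K P (X r)) \<le> M"
          using M[OF X0, of r] r
          by (intro onorm_le) (simp add: mult.commute[of M] mult_left_mono)
      qed (use that in auto)
      then show ?thesis by simp
    qed
    show "continuous_on C g"
      unfolding g_def using k by (intro continuous_intros cont_u) auto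
    show "0 \<le> g x" for x by (rule g0)
    show "x = lifting lam mu K P b (workload mu P (X 0))" if x: "x \<in> C" and "g x = 0" for x
    proof -
      \<comment> \<open>Without external arrivals \<open>gam'\<close> would vanish. A single node
        \<open>i\<close> with positive arrivals suffices, since \<open>g\<close> then compares
        \<open>u x i\<close> with every \<open>u x j\<close>.\<close>
      have "lam \<noteq> 0"
      proof
        assume "lam = 0"
        then have "gam' = 0" by (simp add: gam'_def traffic_rate_def)
        then show False using gam_ne by simp
      qed
      then obtain i where i: "0 < lam $ i"
        using lam by (metis less_le vec_eq_iff zero_index)
      have zero: "\<forall>i j. tau $ i * lam $ i * (bet $ j * gam' $ j) * (u x i - u x j)\<^sup>2 = 0"
        using \<open>g x = 0\<close> k tau_pos gam'_pos bet(2) lam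
        by (simp add: g_def sum_nonneg_eq_0_iff sum_nonneg less_imp_le)
      have "u x j = u x i" for j
        using zero[rule_format, of i j] i tau_pos[of i] gam_ne[of j] bet(2)[of j] by simp
      then have "min (x $ j) (K $ j) = traffic_rate lam P $ j / mu $ j * u x i" for j
        using mu_ne[of j] gam_ne[of j]
        by (metis (no_types, lifting) gam'_def m_def nonzero_mult_div_cancel_left
            times_divide_eq_left times_divide_times_eq u_def mult.commute)
      then show ?thesis
        using lifting_unique[OF inv mu gam tau_pos[unfolded tau_def] assms(8), of x "u x i"] x
        by (simp add: C_def)
    qed
    show "0 \<le> V t" if "0 \<le> t" for t
    proof -
      \<comment> \<open>As \<open>K $ i\<close> is positive, the excess over it is at most
        \<open>X t $ i\<close>.\<close>
      have "(max 0 (X t $ i - K $ i))\<^sup>2 \<le> (X t $ i)\<^sup>2" for i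
        using X0[OF that, of i] K[of i] by (intro power_mono) auto
      then have "0 \<le> F (K $ i) (X t $ i)" for i
        by (simp add: F_def)
      then show ?thesis
        unfolding V_def using tau_pos mu gam'_pos
        by (intro sum_nonneg mult_nonneg_nonneg divide_nonneg_nonneg) (simp_all add: less_imp_le)
    qed
    show "(V has_real_derivative V' t) (at t within {0..})" if "0 \<le> t" for t
    proof -
      have "((\<lambda>t. F (K $ i) (X t $ i)) has_real_derivative
          m (X t) i * fluid_drift lam mu K P (X t) $ i) (at t within {0..})" for i
        unfolding F_def m_def
        by (rule DERIV_chain2[OF has_real_derivative_integral_min Xi'[OF that]])
      then have "(V has_real_derivative (\<Sum>i\<in>UNIV. tau $ i * (mu $ i / gam' $ i) *
          (m (X t) i * fluid_drift lam mu K P (X t) $ i))) (at t within {0..})"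
        unfolding V_def by (intro DERIV_sum DERIV_cmult)
      moreover have "(\<Sum>i\<in>UNIV. tau $ i * (mu $ i / gam' $ i) *
          (m (X t) i * fluid_drift lam mu K P (X t) $ i)) = V' t"
        by (simp add: V'_def u_def algebra_simps)
      ultimately show ?thesis by simp
    qed
    show "V' t \<le> - g (X t)" if "0 \<le> t" for t
      unfolding V'_def using dissip[OF X0[OF that]] by simp
  qed
qed

end
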